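(* For $(m,a)\in\mathbb N\times\mathbb Z$ let $$P_{m;a}:=\{p\mid p\text{ is a prime and }p\mid\tilde\Delta_{m;a}\}.$$ Let $N\in\mathbb N$ and let $p$ and $q$ be two distinct primes dividing $N$. Then $N$ does not satisfy property $(\natural)$ with respect to $(p,q,m;a)$ provided one of the following conditions holds. (1) We have $|a|\ge 3$, $\Delta_{m;a}\ne 0$, and $q\notin P_{m;a}$. (2) We have $p>2$, $2\mid m$, and $a=0$. (3) We have $q\notin P_{m;2}$ and $a=2$. (4) We have $m\in 2\mathbb N$, $q\notin P_{m;-2}$, and $a=-2$. (5) We have $6\mid m$, $q\notin P_{m;1}\cup\{7\}$, and $a=1$. (6) We have $3\mid m$, $q\notin P_{m;-1}$, and $a=-1$.
   Context: $\mathbb N$ is the set of positive integers. Put $\Psi_m(X):=X^m-1$ and let $\mathrm{Res}$ denote the Sylvester resultant. Let $\Delta_{m;a}:=-\mathrm{Res}\bigl(\Psi_m(X),\Psi_m(a-X)\bigr)\in\mathbb Z$. Define $\tilde\Psi_{m;a}(X)\in\mathbb Z[X]$ by: - $a=0$: $\tilde\Psi_{m;0}=X^m-1$ if $2\nmid m$, and $\tilde\Psi_{m;0}=1$ if $2\mid m$; - $a=1$: $\tilde\Psi_{m;1}=X^m-1$ if $6\nmid m$, and $\tilde\Psi_{m;1}=1+X^6+X^{12}+\cdots+X^{m-6}$ if $6\mid m$; - $a=-1$: $\tilde\Psi_{m;-1}=X^m-1$ if $3\nmid m$, and $\tilde\Psi_{m;-1}=1+X^3+X^6+\cdots+X^{m-3}$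 if $3\mid m$; - $a=2$: $\tilde\Psi_{m;2}=1+X+X^2+\cdots+X^{m-1}$; - $a=-2$: $\tilde\Psi_{m;-2}=X^m-1$ if $2\nmid m$, and $\tilde\Psi_{m;-2}=-1+X-X^2+\cdots+X^{m-1}$ if $2\mid m$; - $|a|>2$: $\tilde\Psi_{m;a}=X^m-1$. Let $\tilde\Delta_{m;a}:=\bigl|\mathrm{Res}\bigl(\tilde\Psi_{m;a}(X),\Psi_m(a-X)\bigr)\bigr|$ (so $\tilde\Delta_{m;0}=1$ for $m$ even). Property $(\natural)$ with respect to $(p,q,m;a)$ (where $m\in\mathbb N\setminus\{1,2\}$, $a\in\mathbb Z$, and $p\ne q$ are prime divisors of $N$): $p\nmid m$ and the equation $X^p+Y^p=a$ has a solution $(X_1,Y_1)$ formed by $m$-th roots of unity in an algebraic closure $\overline{\mathbb F_q}$ of $\mathbb F_q$ with $X_1+Y_1\ne a$. *)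

theory Defs
  imports
    "HOL-Number_Theory.Residues"
    "HOL-Algebra.Algebraic_Closure"
    "Subresultants.Resultant_Prelim"
begin

hide_const (open) Divisibility.prime

text \<open>Polynomials over the integers are those of HOL-Computational_Algebra; HOL-Algebra is used for
  the field \<open>\<int>/q\<int>\<close> and its algebraic closure only, because \<open>q\<close> is a variable.\<close>

definition Psi :: "nat \<Rightarrow> int poly" where
  "Psi m = Polynomial.monom 1 m - 1"

definition Psi_refl :: "nat \<Rightarrow> int \<Rightarrow> int poly" \<comment> \<open>\<open>\<Psi>\<^sub>m(a - X)\<close>\<close>
  where "Psi_refl m a = Psi m \<circ>\<^sub>p [:a, -1:]"

definition Delta :: "nat \<Rightarrow> int \<Rightarrow> int" where
  "Delta m a = - resultant (Psi m) (Psi_refl m a)"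

definition Psi_tilde :: "nat \<Rightarrow> int \<Rightarrow> int poly" where
  "Psi_tilde m a =
    (if a = 0 then (if 2 dvd m then 1 else Psi m)
     else if a = 1 then
       (if 6 dvd m then (\<Sum>k<m div 6. Polynomial.monom 1 (6 * k)) else Psi m)
     else if a = -1 then
       (if 3 dvd m then (\<Sum>k<m div 3. Polynomial.monom 1 (3 * k)) else Psi m)
     else if a = 2 then (\<Sum>k<m. Polynomial.monom 1 k)
     else if a = -2 then
       (if 2 dvd m then (\<Sum>k<m. Polynomial.monom ((-1) ^ (k + 1)) k) else Psi m)
     else Psi m)"

definition Delta_tilde :: "nat \<Rightarrow> int \<Rightarrow> int" where
  "Delta_tilde m a = \<bar>resultant (Psi_tilde m a) (Psi_refl m a)\<bar>"

definition P_set :: "nat \<Rightarrow> int \<Rightarrow> nat set" where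
  "P_set m a = {p. prime p \<and> int p dvd Delta_tilde m a}"

text \<open>The library's algebraic closure of \<open>\<int>/q\<int>\<close>; meaningful for prime \<open>q\<close> only.\<close>

abbreviation Fbar :: "nat \<Rightarrow> ((int list \<times> nat) multiset \<Rightarrow> int) ring" where
  "Fbar q \<equiv> field.alg_closure (residue_ring (int q))"

text \<open>Property \<open>(\<natural>)\<close> of \<open>N\<close> with respect to \<open>(p, q, m; a)\<close>. The first two lines are its domain of
  definition; \<open>[a] \<cdot> \<one>\<close> is the image of the integer \<open>a\<close> in the closure.\<close>

definition property_natural :: "nat \<Rightarrow> nat \<Rightarrow> nat \<Rightarrow> nat \<Rightarrow> int \<Rightarrow> bool" where
  "property_natural N p q m a \<longleftrightarrow>
     N > 0 \<and> m > 2 \<and> prime p \<and> prime q \<and> p \<noteq> q \<and>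
     p dvd N \<and> q dvd N \<and>
     \<not> p dvd m \<and>
     (\<exists>x \<in> carrier (Fbar q). \<exists>y \<in> carrier (Fbar q).
        x [^]\<^bsub>Fbar q\<^esub> m = \<one>\<^bsub>Fbar q\<^esub> \<and> y [^]\<^bsub>Fbar q\<^esub> m = \<one>\<^bsub>Fbar q\<^esub> \<and>
        x [^]\<^bsub>Fbar q\<^esub> p \<oplus>\<^bsub>Fbar q\<^esub> y [^]\<^bsub>Fbar q\<^esub> p = [a] \<cdot>\<^bsub>Fbar q\<^esub> \<one>\<^bsub>Fbar q\<^esub> \<and>
        x \<oplus>\<^bsub>Fbar q\<^esub> y \<noteq> [a] \<cdot>\<^bsub>Fbar q\<^esub> \<one>\<^bsub>Fbar q\<^esub>)"

end

theory Submission
  imports Defs "Subresultants.Subresultant"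
begin

text \<open>If \<open>x\<^sup>p + y\<^sup>p = a\<close> with \<open>m\<close>-th roots of unity \<open>x, y\<close>, then \<open>\<alpha> = x\<^sup>p\<close> is a common zero of
  \<open>\<Psi>\<^sub>m(X)\<close> and \<open>\<Psi>\<^sub>m(a - X)\<close>, and for \<open>u\<close> inverse to \<open>p\<close> modulo \<open>m\<close> one has \<open>x = \<alpha>\<^sup>u\<close> and
  \<open>y = (a - \<alpha>)\<^sup>u\<close>. So everything takes place in the prime ideal of \<open>\<int>[X]\<close> of polynomials vanishing at
  \<open>\<alpha>\<close>, and the claim becomes \<open>X\<^sup>u + (a - X)\<^sup>u - a \<in> I\<close>. The resultant lies in the ideal generated
  by the two polynomials, so if \<open>q\<close> does not divide it, then \<open>\<alpha>\<close> and \<open>a - \<alpha>\<close> are zeros of the cofactor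
  of \<open>\<Psi>\<close>-tilde in \<open>\<Psi>\<^sub>m\<close>, which is one of \<open>1\<close>, \<open>X - 1\<close>, \<open>X + 1\<close>, \<open>X\<^sup>6 - 1\<close>, \<open>X\<^sup>3 - 1\<close>; these
  finitely many points are checked by hand. For \<open>a = 1\<close> the points \<open>\<alpha> = -1\<close> and \<open>\<alpha>\<^sup>2 + \<alpha> + 1 = 0\<close>
  force \<open>7 * 9 = 0\<close> and \<open>7 * 4 = 0\<close> in the field, whence the exclusion of \<open>q = 7\<close>.\<close>

section \<open>The resultant as a combination of the two polynomials\<close>

text \<open>\<open>subresultant_mat 0 f g\<close> is a Sylvester matrix whose last row holds
  multiples of \<open>f\<close> and \<open>g\<close> by powers of X. Its determinant is the
  resultant, so Laplace expansion along that row gives the combination; the degree hypothesis makes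
  the row exist.\<close>

lemma resultant_linear_combination:
  fixes f g :: "'a :: comm_ring_1 poly"
  assumes "Polynomial.degree f + Polynomial.degree g > 0"
  shows "\<exists>s t. [:resultant f g:] = s * f + t * g"
proof -
  define n where "n = Polynomial.degree f + Polynomial.degree g"
  define A where "A = subresultant_mat 0 f g"
  have "A \<in> carrier_mat n n"
    by (rule carrier_matI) (simp_all add: A_def n_def)
  then have "[:resultant f g:] = (\<Sum>j<n. A $$ (n - 1, j) * cofactor A (n - 1) j)"
    using assms laplace_expansion_row[of A n "n - 1"]
    by (simp add: A_def n_def subresultant_def flip: subresultant_resultant)
  moreover have "\<exists>s t. A $$ (n - 1, j) * cofactor A (n - 1) j = s * f + t * g" if "j < n" for j
  proof (cases "j < Polynomial.degree g")
    case True
    then have "A $$ (n - 1, j) = Polynomial.monom 1 (Polynomial.degree g - 1 - j) * f"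
      using that assms by (simp add: A_def n_def subresultant_index_mat)
    then show ?thesis
      by (intro exI[of _ "Polynomial.monom 1 (Polynomial.degree g - 1 - j) * cofactor A (n - 1) j"]
          exI[of _ 0]) (simp add: mult_ac)
  next
    case False
    define c where
      "c = Polynomial.monom (1 :: 'a) (Polynomial.degree f - 1 - (j - Polynomial.degree g))"
    have "A $$ (n - 1, j) = c * g"
      using that assms False by (simp add: A_def n_def c_def subresultant_index_mat Let_def)
    then show ?thesis
      by (intro exI[of _ 0] exI[of _ "c * cofactor A (n - 1) j"]) (simp add: mult_ac)
  qed
  then obtain s t where
    "\<And>j. j < n \<Longrightarrow> A $$ (n - 1, j) * cofactor A (n - 1) j = s j * f + t j * g"
    by metis
  ultimately have "[:resultant f g:] = sum s {..<n} * f + sum t {..<n} * g"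
    by (simp add: sum.distrib sum_distrib_right)
  then show ?thesis by blast
qed

section \<open>Prime ideals of integer polynomials\<close>

abbreviation Xpoly :: "int poly" where
  "Xpoly \<equiv> [:0, 1:]"

lemma Psi_conv_power: "Psi m = Xpoly ^ m - 1"
  by (simp add: Psi_def monom_altdef)

lemma linear_refl: "[:a, -1:] = of_int a - Xpoly"
  by (simp add: of_int_poly) (simp only: one_pCons minus_pCons minus_zero)

lemma Psi_refl_conv_power: "Psi_refl m a = (of_int a - Xpoly) ^ m - 1"
  by (simp add: Psi_refl_def Psi_conv_power pcompose_diff pcompose_hom.hom_power pcompose_pCons
      linear_refl)

lemma degree_Psi: "m > 0 \<Longrightarrow> Polynomial.degree (Psi m) = m"
  unfolding Psi_def diff_conv_add_uminus
  by (subst degree_add_eq_left) (auto simp: degree_monom_eq)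

lemma degree_Psi_refl: "m > 0 \<Longrightarrow> Polynomial.degree (Psi_refl m a) = m"
  by (simp add: Psi_refl_def degree_Psi)

text \<open>Abstracts the kernel of evaluation at a point of a field of characteristic
  \<open>q\<close>; \<open>of_int_mem\<close> encodes the characteristic.\<close>

locale int_poly_prime_ideal =
  fixes I :: "int poly set" and q :: nat
  assumes zero_mem: "0 \<in> I"
    and add_mem: "f \<in> I \<Longrightarrow> g \<in> I \<Longrightarrow> f + g \<in> I"
    and mult_mem: "f \<in> I \<Longrightarrow> g * f \<in> I"
    and prime_mem: "f * g \<in> I \<Longrightarrow> f \<in> I \<or> g \<in> I"
    and of_int_mem: "of_int n \<in> I \<Longrightarrow> int q dvd n"
    and prime_q: "prime q"
begin

lemma dvd_mem: "f \<in> I \<Longrightarrow> f dvd g \<Longrightarrow> g \<in> I"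
  by (metis dvdE mult.commute mult_mem)

lemma diff_mem: "f \<in> I \<Longrightarrow> g \<in> I \<Longrightarrow> f - g \<in> I"
  using add_mem[of f "- g"] mult_mem[of g "- 1"] by simp

lemma one_not_mem: "1 \<notin> I"
  using of_int_mem[of 1] prime_q by (auto simp: prime_nat_iff)

text \<open>The resultant is an integer prime to \<open>q\<close>, hence outside \<open>I\<close>,
  and it is a combination of \<open>T\<close> and \<open>Psi_refl m a\<close>; so \<open>T\<close>
  is outside \<open>I\<close> and primality puts \<open>D\<close> inside. The substitution of a - X
  for X swaps \<open>Psi m\<close> and \<open>Psi_refl m a\<close>, which gives the reflected
  half.\<close>

lemma cofactor_mem:
  assumes "Psi m \<in> I" "Psi_refl m a \<in> I" "m > 0"
    and "T = Psi_tilde m a" "D * T = Psi m"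
    and "q \<notin> P_set m a"
  shows "D \<in> I \<and> D \<circ>\<^sub>p [:a, -1:] \<in> I"
proof -
  have res: "of_int (resultant T (Psi_refl m a)) \<notin> I"
    using of_int_mem assms(4,6) prime_q by (auto simp: P_set_def Delta_tilde_def)
  obtain s t where st: "of_int (resultant T (Psi_refl m a)) = s * T + t * Psi_refl m a"
    using resultant_linear_combination[of T "Psi_refl m a"] assms(3)
    by (auto simp: degree_Psi_refl of_int_poly)
  have "T \<notin> I"
    using res assms(2) by (metis st add_mem mult_mem)
  moreover have "T \<circ>\<^sub>p [:a, -1:] \<notin> I"
  proof
    assume "T \<circ>\<^sub>p [:a, -1:] \<in> I"
    \<comment> \<open>The resultant is constant, so reflecting the identity leaves its left side
      unchanged.\<close>
    moreover have "of_int (resultant T (Psi_refl m a))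
        = (s \<circ>\<^sub>p [:a, -1:]) * (T \<circ>\<^sub>p [:a, -1:]) + (t \<circ>\<^sub>p [:a, -1:]) * (Psi_refl m a \<circ>\<^sub>p [:a, -1:])"
      using arg_cong[OF st, of "\<lambda>h. h \<circ>\<^sub>p [:a, -1:]"]
      by (simp add: pcompose_add pcompose_mult of_int_poly)
    moreover have "[:a, -1:] \<circ>\<^sub>p [:a, -1:] = Xpoly"
      by (simp add: pcompose_pCons)
    then have "Psi_refl m a \<circ>\<^sub>p [:a, -1:] = Psi m"
      by (simp only: Psi_refl_def pcompose_idR flip: pcompose_assoc)
    ultimately show False
      using res assms(1) by (metis add_mem mult_mem)
  qed
  moreover have "D * T \<in> I" "(D \<circ>\<^sub>p [:a, -1:]) * (T \<circ>\<^sub>p [:a, -1:]) \<in> I"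
    using assms(1,2,5) by (simp_all add: Psi_refl_def flip: pcompose_mult)
  ultimately show ?thesis
    using prime_mem by blast
qed

lemma power_mod_mem:
  assumes "f ^ d - 1 \<in> I"
  shows "f ^ u - f ^ (u mod d) \<in> I"
proof -
  have "f ^ d - 1 dvd (f ^ d) ^ (u div d) - 1"
    using power_diff_1_eq[of "f ^ d" "u div d"] by simp
  then have "f ^ d - 1 dvd f ^ (u mod d) * ((f ^ d) ^ (u div d) - 1)"
    by (rule dvd_mult)
  also have "\<dots> = f ^ u - f ^ (u mod d)"
    by (simp add: algebra_simps flip: power_mult power_add)
  finally show ?thesis using dvd_mem assms by blast
qed

text \<open>Leaves only the residue of \<open>u\<close> modulo \<open>d\<close> to be
  checked.\<close>

lemma power_sum_mod_mem:
  assumes "f ^ d - 1 \<in> I" "g ^ d - 1 \<in> I"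
    and "f ^ (u mod d) + g ^ (u mod d) - c \<in> I"
  shows "f ^ u + g ^ u - c \<in> I"
proof -
  have "f ^ u + g ^ u - c = (f ^ u - f ^ (u mod d)) + (g ^ u - g ^ (u mod d))
      + (f ^ (u mod d) + g ^ (u mod d) - c)"
    by simp
  then show ?thesis
    using assms by (metis power_mod_mem add_mem)
qed

end

section \<open>Explicit factorizations of X^m - 1\<close>

lemma geometric_sum_mult:
  assumes "d dvd m"
  shows "Psi d * (\<Sum>k<m div d. Polynomial.monom 1 (d * k)) = Psi m"
proof -
  have "Psi d * (\<Sum>k<m div d. Polynomial.monom 1 (d * k))
      = (Xpoly ^ d - 1) * (\<Sum>k<m div d. (Xpoly ^ d) ^ k)"
    by (simp add: Psi_conv_power monom_altdef power_mult)
  also have "\<dots> = (Xpoly ^ d) ^ (m div d) - 1"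
    by (rule power_diff_1_eq[symmetric])
  also have "\<dots> = Psi m"
    using assms by (simp add: Psi_conv_power flip: power_mult)
  finally show ?thesis .
qed

text \<open>A geometric sum in -X; evenness of \<open>m\<close> turns (-X)^m into X^m.\<close>

lemma alternating_sum_mult:
  assumes "even m"
  shows "(Xpoly + 1) * (\<Sum>k<m. Polynomial.monom ((-1) ^ (k + 1)) k) = Psi m"
proof -
  have "Polynomial.monom ((-1) ^ (k + 1)) k = - ((- Xpoly) ^ k)" for k
    by (subst power_minus) (cases "even k"; simp add: monom_altdef)
  then have "(Xpoly + 1) * (\<Sum>k<m. Polynomial.monom ((-1) ^ (k + 1)) k)
      = (- Xpoly - 1) * (\<Sum>k<m. (- Xpoly) ^ k)"
    by (simp add: sum_negf algebra_simps)
  also have "\<dots> = (- Xpoly) ^ m - 1"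
    by (rule power_diff_1_eq[symmetric])
  finally show ?thesis
    by (simp only: Psi_conv_power power_minus_even assms)
qed

section \<open>The power sum at the exceptional points\<close>

context int_poly_prime_ideal
begin

text \<open>At a zero of w^2 - w + 1 the elements w and 1 - w are mutually inverse, and
  \<open>u\<close> is 1 or -1 modulo 6, so u-th powers at most swap them. The other zeros of X^6 - 1
  are excluded or, in characteristic 2 or 3, are zeros of this factor too.\<close>

lemma power_sum_mem_one:
  assumes "Xpoly ^ 6 - 1 \<in> I" "(1 - Xpoly) ^ 6 - 1 \<in> I" "q \<noteq> 7" "coprime u 6"
  shows "Xpoly ^ u + (1 - Xpoly) ^ u - 1 \<in> I"
proof -
  define w where "w = Xpoly"
  note hyps = assms(1,2)[folded w_def]
  have seven: "of_int 7 \<notin> I"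
  proof
    assume "of_int 7 \<in> I"
    then have "q dvd 7"
      using of_int_mem[of 7] int_dvd_int_iff[of q 7] by simp
    then show False
      using primes_dvd_imp_eq[of q 7] prime_q assms(3) by simp
  qed
  \<comment> \<open>The four cyclotomic factors of X^6 - 1.\<close>
  have "((w - 1) * (w + 1)) * ((w\<^sup>2 + w + 1) * (w\<^sup>2 - w + 1)) \<in> I"
    using hyps(1) by (rule back_subst[of "\<lambda>f. f \<in> I"])
        (simp add: algebra_simps power_numeral_reduce)
  then consider "w - 1 \<in> I" | "w + 1 \<in> I" | "w\<^sup>2 + w + 1 \<in> I" | "w\<^sup>2 - w + 1 \<in> I"
    using prime_mem by blast
  then have Phi6: "w\<^sup>2 - w + 1 \<in> I"
  proof cases
    case 1
    \<comment> \<open>At w = 1 the reflected point is 0, which is no root of unity.\<close>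
    have eq: "(w - 1) ^ 5 * (w - 1) - ((1 - w) ^ 6 - 1) = 1"
      by (simp add: algebra_simps power_numeral_reduce)
    have "(w - 1) ^ 5 * (w - 1) - ((1 - w) ^ 6 - 1) \<in> I"
      by (intro diff_mem mult_mem 1 hyps(2))
    then show ?thesis
      unfolding eq using one_not_mem by blast
  next
    case 2
    \<comment> \<open>Division by w + 1 leaves the value at w = -1, which is 2^6 - 1 = 63.\<close>
    have eq: "of_int 7 * (of_int 3 * of_int 3) = ((1 - w) ^ 6 - 1)
        - (w ^ 5 - 7 * w ^ 4 + 22 * w ^ 3 - 42 * w\<^sup>2 + 57 * w - 63) * (w + 1)"
      by (simp add: algebra_simps power_numeral_reduce)
    have "of_int 7 * (of_int 3 * of_int 3) \<in> I"
      unfolding eq by (intro diff_mem mult_mem 2 hyps(2))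
    then have three: "of_int 3 \<in> I"
      using prime_mem seven by blast
    \<comment> \<open>Modulo 3 the wanted factor is (w + 1)^2.\<close>
    have eq: "w\<^sup>2 - w + 1 = (w - 2) * (w + 1) + of_int 3"
      by (simp add: algebra_simps power_numeral_reduce)
    show ?thesis
      unfolding eq by (intro add_mem mult_mem 2 three)
  next
    case 3
    \<comment> \<open>Modulo w^2 + w + 1 one has (1 - w)^2 = -3w and w^3 = 1, so (1 - w)^6 - 1 =
      -28.\<close>
    have eq: "of_int 7 * (of_int 2 * of_int 2)
        = (w ^ 4 - 7 * w ^ 3 + 21 * w\<^sup>2 - 34 * w + 28) * (w\<^sup>2 + w + 1) - ((1 - w) ^ 6 - 1)"
      by (simp add: algebra_simps power_numeral_reduce)
    have "of_int 7 * (of_int 2 * of_int 2) \<in> I"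
      unfolding eq by (intro diff_mem mult_mem 3 hyps(2))
    then have two: "of_int 2 \<in> I"
      using prime_mem seven by blast
    have eq: "w\<^sup>2 - w + 1 = (w\<^sup>2 + w + 1) - w * of_int 2"
      by simp
    show ?thesis
      unfolding eq by (intro diff_mem mult_mem 3 two)
  qed
  have "\<not> 2 dvd u" "\<not> 3 dvd u"
    using coprime_common_divisor[OF assms(4), of 2] coprime_common_divisor[OF assms(4), of 3]
    by auto
  then have "u mod 6 = 1 \<or> u mod 6 = 5" by presburger
  then have "w ^ (u mod 6) + (1 - w) ^ (u mod 6) - 1 \<in> I"
  proof
    assume u: "u mod 6 = 5"
    have eq: "w ^ 5 + (1 - w) ^ 5 - 1 = (5 * w\<^sup>2 - 5 * w) * (w\<^sup>2 - w + 1)"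
      by (simp add: algebra_simps power_numeral_reduce)
    show ?thesis
      unfolding u eq by (rule mult_mem[OF Phi6])
  qed (simp add: zero_mem)
  then show ?thesis
    unfolding w_def by (rule power_sum_mod_mem[OF assms(1,2)])
qed

text \<open>At a zero of w^2 + w + 1 the element -1 - w is w^2, the inverse of w, and
  \<open>u\<close> is 1 or -1 modulo 3. The remaining point w = 1 forces characteristic 3, where w^2
  + w + 1 = (w - 1)^2.\<close>

lemma power_sum_mem_minus_one:
  assumes "Xpoly ^ 3 - 1 \<in> I" "(-1 - Xpoly) ^ 3 - 1 \<in> I" "coprime u 3"
  shows "Xpoly ^ u + (-1 - Xpoly) ^ u - (-1) \<in> I"
proof -
  define w where "w = Xpoly"
  note hyps = assms(1,2)[folded w_def]
  have Phi3: "w\<^sup>2 + w + 1 \<in> I"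
  proof -
    have "(w - 1) * (w\<^sup>2 + w + 1) \<in> I"
      using hyps(1) by (rule back_subst[of "\<lambda>f. f \<in> I"])
        (simp add: algebra_simps power_numeral_reduce)
    then consider "w - 1 \<in> I" | "w\<^sup>2 + w + 1 \<in> I"
      using prime_mem by blast
    then show ?thesis
    proof cases
      case 1
      \<comment> \<open>At w = 1 the reflected condition reads (-2)^3 - 1 = -9.\<close>
      have eq: "of_int 3 * of_int 3 = (-1) * ((-1 - w) ^ 3 - 1) - (w\<^sup>2 + 4 * w + 7) * (w - 1)"
        by (simp add: algebra_simps power_numeral_reduce)
      have "of_int 3 * of_int 3 \<in> I"
        unfolding eq by (intro diff_mem mult_mem 1 hyps(2))
      then have three: "of_int 3 \<in> I"
        using prime_mem by blast
      have eq: "w\<^sup>2 + w + 1 = (w + 2) * (w - 1) + of_int 3"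
        by (simp add: algebra_simps power_numeral_reduce)
      show ?thesis
        unfolding eq by (intro add_mem mult_mem 1 three)
    qed
  qed
  have "\<not> 3 dvd u"
    using coprime_common_divisor[OF assms(3), of 3] by auto
  then have "u mod 3 = 1 \<or> u mod 3 = 2" by presburger
  then have "w ^ (u mod 3) + (-1 - w) ^ (u mod 3) - (-1) \<in> I"
  proof
    assume u: "u mod 3 = 2"
    have eq: "w\<^sup>2 + (-1 - w)\<^sup>2 - (-1) = 2 * (w\<^sup>2 + w + 1)"
      by (simp add: algebra_simps power_numeral_reduce)
    show ?thesis
      unfolding u eq by (rule mult_mem[OF Phi3])
  qed (simp add: zero_mem)
  then show ?thesis
    unfolding w_def by (rule power_sum_mod_mem[OF assms(1,2)])
qed

text \<open>For nonzero \<open>a\<close>, \<open>cofactor_mem\<close> confines the point and its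
  reflection to the zeros of an explicit cofactor; for \<open>a = 0\<close> the polynomial itself
  vanishes.\<close>

lemma power_sum_mem:
  assumes "Psi m \<in> I" "Psi_refl m a \<in> I" "m > 0" "coprime u m"
    and "(\<bar>a\<bar> \<ge> 3 \<and> q \<notin> P_set m a)
       \<or> (2 dvd m \<and> a = 0)
       \<or> (q \<notin> P_set m 2 \<and> a = 2)
       \<or> (2 dvd m \<and> q \<notin> P_set m (-2) \<and> a = -2)
       \<or> (6 dvd m \<and> q \<notin> P_set m 1 \<union> {7} \<and> a = 1)
       \<or> (3 dvd m \<and> q \<notin> P_set m (-1) \<and> a = -1)"
  shows "Xpoly ^ u + [:a, -1:] ^ u - of_int a \<in> I"
proof -
  note cofactor = cofactor_mem[OF assms(1-3)]
  have odd_u: "odd u" if "even m"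
    using that assms(4) by (metis coprime_common_divisor odd_one)
  consider
      (large) "\<bar>a\<bar> \<ge> 3" "q \<notin> P_set m a"
    | (zero) "even m" "a = 0"
    | (two) "q \<notin> P_set m a" "a = 2"
    | (minus_two) "even m" "q \<notin> P_set m a" "a = -2"
    | (one) "6 dvd m" "q \<notin> P_set m a" "q \<noteq> 7" "a = 1"
    | (minus_one) "3 dvd m" "q \<notin> P_set m a" "a = -1"
    using assms(5) by auto
  then show ?thesis
  proof cases
    case large
    then have "Psi_tilde m a = Psi m"
      by (auto simp: Psi_tilde_def)
    \<comment> \<open>The cofactor is 1, so there is no common zero at all.\<close>
    then have "1 \<in> I"
      using cofactor[of _ 1] large by simp
    then show ?thesis using one_not_mem by simp
  next
    case zero
    \<comment> \<open>\<open>u\<close> is coprime to the even \<open>m\<close>, hence odd, and X^u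
      cancels (-X)^u.\<close>
    have "Xpoly ^ u + [:a, -1:] ^ u - of_int a = 0"
      using odd_u[OF zero(1)] zero(2)
      by (simp only: linear_refl of_int_0 diff_0 power_minus_odd not_False_eq_True
          add.right_inverse diff_self)
    then show ?thesis using zero_mem by simp
  next
    case two
    \<comment> \<open>Only the point 1 survives; its reflection 2 - 1 is again 1.\<close>
    then have "Xpoly - 1 \<in> I"
      using cofactor[of _ "Xpoly - 1"] geometric_sum_mult[of 1 m]
      by (simp add: Psi_tilde_def Psi_conv_power)
    moreover have "Xpoly - 1 = [:-1, 1:]"
      by (simp only: one_pCons diff_pCons) simp
    moreover have "poly (Xpoly ^ u + [:a, -1:] ^ u - of_int a) 1 = 0"
      using two by (simp add: of_int_poly)
    then have "[:-1, 1:] dvd Xpoly ^ u + [:a, -1:] ^ u - of_int a"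
      by (simp only: poly_eq_0_iff_dvd)
    ultimately show ?thesis by (metis dvd_mem)
  next
    case minus_two
    \<comment> \<open>Only the point -1 survives; it is its own reflection, and odd \<open>u\<close>
      gives the sum -2.\<close>
    then have "Xpoly + 1 \<in> I"
      using cofactor[of _ "Xpoly + 1"] alternating_sum_mult[of m] by (simp add: Psi_tilde_def)
    moreover have "Xpoly + 1 = [:1, 1:]"
      by (simp only: one_pCons add_pCons) simp
    moreover have "poly (Xpoly ^ u + [:a, -1:] ^ u - of_int a) (-1) = 0"
      using minus_two odd_u by (simp add: of_int_poly)
    then have "[:1, 1:] dvd Xpoly ^ u + [:a, -1:] ^ u - of_int a"
      by (simp only: poly_eq_0_iff_dvd minus_minus)
    ultimately show ?thesis by (metis dvd_mem)
  next
    case one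
    \<comment> \<open>The reflection of the cofactor \<open>Psi 6\<close> is
      \<open>Psi_refl 6 a\<close> by definition, so one cofactor supplies both sixth-power
      conditions.\<close>
    have "Psi 6 \<in> I \<and> Psi_refl 6 a \<in> I"
      unfolding Psi_refl_def using cofactor[of _ "Psi 6"] geometric_sum_mult[of 6 m] one
      by (simp add: Psi_tilde_def)
    moreover have "coprime u 6"
      using assms(4) one(1) by (metis coprime_divisors dvd_refl)
    ultimately show ?thesis
      using power_sum_mem_one[of u] one
      by (simp only: Psi_conv_power Psi_refl_conv_power linear_refl of_int_1 of_int_minus) simp
  next
    case minus_one
    have "Psi 3 \<in> I \<and> Psi_refl 3 a \<in> I"
      unfolding Psi_refl_def using cofactor[of _ "Psi 3"] geometric_sum_mult[of 3 m] minus_one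
      by (simp add: Psi_tilde_def)
    moreover have "coprime u 3"
      using assms(4) minus_one(1) by (metis coprime_divisors dvd_refl)
    ultimately show ?thesis
      using power_sum_mem_minus_one[of u] minus_one
      by (simp only: Psi_conv_power Psi_refl_conv_power linear_refl of_int_1 of_int_minus)
  qed
qed

end

section \<open>Evaluating integer polynomials in a field\<close>

context ring
begin

lemma of_int_zero: "[(0 :: int)] \<cdot> \<one> = \<zero>"
  by (simp add: add_pow_int_ge)

lemma of_int_add: "[(c + d :: int)] \<cdot> \<one> = [c] \<cdot> \<one> \<oplus> [d] \<cdot> \<one>"
  using add.int_pow_mult[of \<one> c d] by simp

lemma of_int_mult: "[(c * d :: int)] \<cdot> \<one> = [c] \<cdot> \<one> \<otimes> [d] \<cdot> \<one>"
  using add.int_pow_pow[of \<one> c d] by (simp add: add_pow_ldistr_int mult.commute[of c d])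

end

context cring
begin

text \<open>Horner form of the ring homomorphism from \<open>int poly\<close> that sends X to a
  carrier element \<open>x\<close>.\<close>

definition int_poly_eval :: "'a \<Rightarrow> int poly \<Rightarrow> 'a" where
  "int_poly_eval x f = fold_coeffs (\<lambda>c y. [c] \<cdot> \<one> \<oplus> x \<otimes> y) f \<zero>"

lemma int_poly_eval_0 [simp]: "int_poly_eval x 0 = \<zero>"
  by (simp add: int_poly_eval_def)

lemma int_poly_eval_pCons [simp]:
  "x \<in> carrier R \<Longrightarrow> int_poly_eval x (pCons c f) = [c] \<cdot> \<one> \<oplus> x \<otimes> int_poly_eval x f"
  by (cases "f = 0"; cases "c = 0") (simp_all add: int_poly_eval_def of_int_zero)

context
  fixes x assumes x [simp]: "x \<in> carrier R"
begin

lemma int_poly_eval_closed [simp]: "int_poly_eval x f \<in> carrier R"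
  by (induction f) simp_all

lemma int_poly_eval_add: "int_poly_eval x (f + g) = int_poly_eval x f \<oplus> int_poly_eval x g"
  by (induction f g rule: poly_induct2) (simp_all add: of_int_add r_distr a_ac)

lemma int_poly_eval_smult: "int_poly_eval x (smult c f) = [c] \<cdot> \<one> \<otimes> int_poly_eval x f"
  by (induction f) (simp_all add: of_int_mult r_distr m_lcomm)

lemma int_poly_eval_mult: "int_poly_eval x (f * g) = int_poly_eval x f \<otimes> int_poly_eval x g"
  by (induction f)
    (simp_all add: int_poly_eval_add int_poly_eval_smult l_distr m_assoc of_int_zero)

lemma int_poly_eval_1: "int_poly_eval x 1 = \<one>"
  using int_poly_eval_pCons[OF x, of 1 0] by simp

lemma int_poly_eval_power: "int_poly_eval x (f ^ n) = int_poly_eval x f [^] n"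
  by (induction n) (simp_all add: int_poly_eval_1 int_poly_eval_mult m_comm)

lemma int_poly_eval_diff: "int_poly_eval x (f - g) = int_poly_eval x f \<ominus> int_poly_eval x g"
proof -
  have "int_poly_eval x (f - g) \<oplus> int_poly_eval x g = int_poly_eval x f"
    by (simp flip: int_poly_eval_add)
  then show ?thesis
    by (metis add.inv_solve_right int_poly_eval_closed minus_eq)
qed

lemma int_poly_eval_X: "int_poly_eval x Xpoly = x"
  by (simp add: int_poly_eval_1 of_int_zero)

lemma int_poly_eval_of_int: "int_poly_eval x (of_int c) = [c] \<cdot> \<one>"
  by (simp add: of_int_poly)

lemma int_poly_eval_refl: "int_poly_eval x [:a, -1:] = [a] \<cdot> \<one> \<ominus> x"
  by (simp only: linear_refl int_poly_eval_diff int_poly_eval_of_int int_poly_eval_X)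

end

end

lemma (in domain) int_poly_prime_ideal_vanishing:
  assumes "x \<in> carrier R" "prime q" and "\<And>n :: int. [n] \<cdot> \<one> = \<zero> \<Longrightarrow> int q dvd n"
  shows "int_poly_prime_ideal {f. int_poly_eval x f = \<zero>} q"
  using assms
  by unfold_locales
    (auto simp: int_poly_eval_add int_poly_eval_mult int_poly_eval_of_int integral_iff)

section \<open>The characteristic of the algebraic closure\<close>

text \<open>Otherwise a Bezout relation between \<open>q\<close> and \<open>n\<close> would map to
  \<open>\<one> = \<zero>\<close>.\<close>

lemma (in ring) of_int_eq_zero_imp_dvd:
  assumes "prime q" "[q] \<cdot> \<one> = \<zero>" "\<one> \<noteq> \<zero>" "[(n :: int)] \<cdot> \<one> = \<zero>"
  shows "int q dvd n"
proof (rule ccontr)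
  assume "\<not> int q dvd n"
  then have "coprime (int q) n"
    using assms(1) by (simp add: prime_imp_coprime)
  then obtain u v where "u * int q + v * n = 1"
    by (metis bezout_int coprime_imp_gcd_eq_1)
  then have "\<one> = [(u * int q + v * n)] \<cdot> \<one>" by simp
  also have "\<dots> = [u] \<cdot> \<one> \<otimes> [(int q)] \<cdot> \<one> \<oplus> [v] \<cdot> \<one> \<otimes> [n] \<cdot> \<one>"
    by (simp only: of_int_add of_int_mult)
  also have "\<dots> = \<zero>"
    using assms(2,4) by (simp add: add_pow_int_ge)
  finally show False using assms(3) by simp
qed

lemma
  assumes "prime q"
  shows field_Fbar: "field (Fbar q)"
    and Fbar_char: "[q] \<cdot>\<^bsub>Fbar q\<^esub> \<one>\<^bsub>Fbar q\<^esub> = \<zero>\<^bsub>Fbar q\<^esub>"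
proof -
  interpret F: residues_prime q "residue_ring (int q)"
    using assms by unfold_locales simp_all
  show "field (Fbar q)"
    using F.alg_closureE(1) by (simp add: algebraic_closure_def)
  then interpret K: field "Fbar q" .
  interpret h: ring_hom_ring "residue_ring (int q)" "Fbar q" F.indexed_const
    using F.alg_closureE(2) by (intro ring_hom_ringI2) unfold_locales
  \<comment> \<open>The embedding of the prime field computes multiples of one through residues; at
    \<open>n = q\<close> the residue is 0.\<close>
  have "[n] \<cdot>\<^bsub>Fbar q\<^esub> \<one>\<^bsub>Fbar q\<^esub> = F.indexed_const (int n mod int q)" for n
  proof (induction n)
    case 0
    then show ?case using h.hom_zero by (simp add: F.res_zero_eq)
  next
    case (Suc n)
    have "F.indexed_const (int (Suc n) mod int q)
        = F.indexed_const ((int n mod int q) \<oplus>\<^bsub>residue_ring (int q)\<^esub> \<one>\<^bsub>residue_ring (int q)\<^esub>)"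
      by (simp add: F.res_add_eq F.res_one_eq mod_simps add.commute)
    also have "\<dots> = F.indexed_const (int n mod int q) \<oplus>\<^bsub>Fbar q\<^esub> \<one>\<^bsub>Fbar q\<^esub>"
      by (subst h.hom_add) simp_all
    finally show ?case using Suc.IH by simp
  qed
  from this[of q] show "[q] \<cdot>\<^bsub>Fbar q\<^esub> \<one>\<^bsub>Fbar q\<^esub> = \<zero>\<^bsub>Fbar q\<^esub>"
    using h.hom_zero by (simp add: F.res_zero_eq)
qed

section \<open>Return to the roots of unity\<close>

lemma (in monoid) pow_cong_one:
  fixes m n :: nat
  assumes "x \<in> carrier G" "x [^] m = \<one>" "[n = 1] (mod m)"
  shows "x [^] n = x"
proof -
  have red: "x [^] k = x [^] (k mod m)" for k :: nat
  proof -
    have "x [^] k = x [^] (m * (k div m) + k mod m)"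
      by simp
    also have "\<dots> = (x [^] m) [^] (k div m) \<otimes> x [^] (k mod m)"
      using assms(1) by (simp only: nat_pow_mult nat_pow_pow)
    finally show ?thesis using assms(1,2) by simp
  qed
  show ?thesis
    using red[of n] red[of 1] assms(1,3) by (simp add: cong_def)
qed

theorem proposition7p4:
  fixes N p q m :: nat and a :: int
  assumes "N > 0" and "m > 2"
    and "prime p" and "prime q" and "p \<noteq> q" and "p dvd N" and "q dvd N"
    and "(\<bar>a\<bar> \<ge> 3 \<and> Delta m a \<noteq> 0 \<and> q \<notin> P_set m a)
       \<or> (p > 2 \<and> 2 dvd m \<and> a = 0)
       \<or> (q \<notin> P_set m 2 \<and> a = 2)
       \<or> (2 dvd m \<and> q \<notin> P_set m (-2) \<and> a = -2)
       \<or> (6 dvd m \<and> q \<notin> P_set m 1 \<union> {7} \<and> a = 1)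
       \<or> (3 dvd m \<and> q \<notin> P_set m (-1) \<and> a = -1)"
  shows "\<not> property_natural N p q m a"
proof
  assume nat: "property_natural N p q m a"
  define K where "K = Fbar q"
  interpret K: field K
    unfolding K_def using assms(4) by (rule field_Fbar)
  from nat obtain x y where xy: "x \<in> carrier K" "y \<in> carrier K"
      "x [^]\<^bsub>K\<^esub> m = \<one>\<^bsub>K\<^esub>" "y [^]\<^bsub>K\<^esub> m = \<one>\<^bsub>K\<^esub>"
      "x [^]\<^bsub>K\<^esub> p \<oplus>\<^bsub>K\<^esub> y [^]\<^bsub>K\<^esub> p = [a] \<cdot>\<^bsub>K\<^esub> \<one>\<^bsub>K\<^esub>"
      "x \<oplus>\<^bsub>K\<^esub> y \<noteq> [a] \<cdot>\<^bsub>K\<^esub> \<one>\<^bsub>K\<^esub>"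
    and p: "\<not> p dvd m"
    unfolding property_natural_def K_def by blast
  define \<alpha> where "\<alpha> = x [^]\<^bsub>K\<^esub> p"
  define ev where "ev = K.int_poly_eval \<alpha>"
  have \<alpha> [simp]: "\<alpha> \<in> carrier K" using xy by (simp add: \<alpha>_def)
  interpret I: int_poly_prime_ideal "{f. ev f = \<zero>\<^bsub>K\<^esub>}" q
    unfolding ev_def using \<alpha> assms(4)
  proof (rule K.int_poly_prime_ideal_vanishing)
    show "int q dvd n" if "[n] \<cdot>\<^bsub>K\<^esub> \<one>\<^bsub>K\<^esub> = \<zero>\<^bsub>K\<^esub>" for n :: int
      using K.of_int_eq_zero_imp_dvd[OF assms(4) _ K.one_not_zero that] Fbar_char[OF assms(4)]
      by (simp add: K_def)
  qed
  have ev_X: "ev Xpoly = \<alpha>"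
    unfolding ev_def using \<alpha> by (rule K.int_poly_eval_X)
  have ev_refl: "ev [:a, -1:] = y [^]\<^bsub>K\<^esub> p"
  proof -
    have "[a] \<cdot>\<^bsub>K\<^esub> \<one>\<^bsub>K\<^esub> \<ominus>\<^bsub>K\<^esub> \<alpha> = y [^]\<^bsub>K\<^esub> p"
      using xy K.r_neg1 by (simp add: \<alpha>_def K.minus_eq K.a_ac flip: xy(5))
    then show ?thesis by (simp only: ev_def K.int_poly_eval_refl[OF \<alpha>])
  qed
  have ev_power: "ev (f ^ n) = ev f [^]\<^bsub>K\<^esub> n" for f n
    by (simp add: ev_def K.int_poly_eval_power)
  have pow_m: "(z [^]\<^bsub>K\<^esub> p) [^]\<^bsub>K\<^esub> m = \<one>\<^bsub>K\<^esub>"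
    if "z \<in> carrier K" "z [^]\<^bsub>K\<^esub> m = \<one>\<^bsub>K\<^esub>" for z
    using that by (metis K.nat_pow_pow K.nat_pow_one mult.commute)
  have "ev (Psi m) = \<zero>\<^bsub>K\<^esub>"
  proof -
    have "ev (Psi m) = ev Xpoly [^]\<^bsub>K\<^esub> m \<ominus>\<^bsub>K\<^esub> \<one>\<^bsub>K\<^esub>"
      by (simp only: Psi_conv_power ev_power[symmetric])
        (simp add: ev_def K.int_poly_eval_diff K.int_poly_eval_1)
    then show ?thesis
      using pow_m[of x] xy by (simp only: ev_X) (simp add: \<alpha>_def K.minus_eq K.r_neg)
  qed
  moreover have "ev (Psi_refl m a) = \<zero>\<^bsub>K\<^esub>"
  proof -
    have "ev (Psi_refl m a) = ev [:a, -1:] [^]\<^bsub>K\<^esub> m \<ominus>\<^bsub>K\<^esub> \<one>\<^bsub>K\<^esub>"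
      by (simp only: Psi_refl_conv_power linear_refl ev_power[symmetric])
        (simp add: ev_def K.int_poly_eval_diff K.int_poly_eval_1)
    then show ?thesis
      using pow_m[of y] xy by (simp only: ev_refl) (simp add: K.minus_eq K.r_neg)
  qed
  moreover have "coprime p m"
    using assms(3) p by (simp add: prime_imp_coprime)
  then obtain u where u: "[p * u = 1] (mod m)"
    by (metis One_nat_def cong_solve_coprime_nat)
  then have "coprime u m"
    by (metis coprime_iff_invertible_nat mult.commute One_nat_def)
  ultimately have "ev (Xpoly ^ u + [:a, -1:] ^ u - of_int a) = \<zero>\<^bsub>K\<^esub>"
    using I.power_sum_mem[of m a u] assms(2,8) by auto
  then have "ev Xpoly [^]\<^bsub>K\<^esub> u \<oplus>\<^bsub>K\<^esub> ev [:a, -1:] [^]\<^bsub>K\<^esub> u \<ominus>\<^bsub>K\<^esub> [a] \<cdot>\<^bsub>K\<^esub> \<one>\<^bsub>K\<^esub> = \<zero>\<^bsub>K\<^esub>"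
    unfolding ev_def
    by (simp only: K.int_poly_eval_diff[OF \<alpha>] K.int_poly_eval_add[OF \<alpha>]
        K.int_poly_eval_power[OF \<alpha>] K.int_poly_eval_of_int[OF \<alpha>])
  \<comment> \<open>On m-th roots of unity u-th powers undo p-th powers, so the vanishing power sum
    becomes x + y = a.\<close>
  then have "x \<oplus>\<^bsub>K\<^esub> y \<ominus>\<^bsub>K\<^esub> [a] \<cdot>\<^bsub>K\<^esub> \<one>\<^bsub>K\<^esub> = \<zero>\<^bsub>K\<^esub>"
    using K.pow_cong_one[OF _ _ u] xy by (simp only: ev_X ev_refl \<alpha>_def K.nat_pow_pow)
  then show False
    using xy by (simp add: K.r_right_minus_eq)
qed

end
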